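(* Let $1<p<\infty$, let $v$ be a weight function on $\mathbb{R}^2$, and let $\phi\in L^1(\mathbb{R}^2)$. Let the following be satisfied for some constant $c>0$ (independent of $t_1,t_2$): $$\sup_{(y_1,y_2)\in\mathbb{R}^2}\left(\frac{v(t_1y_1,t_2y_2)}{v(y_1,y_2)}\right)\le c\inf_{(y_1,y_2)\in\mathbb{R}^2}\left(\frac{v(t_1y_1,t_2y_2)}{v(y_1,y_2)}\right)\qquad\text{for all nonzero real } t_1,t_2.$$ Put $$\mathscr{A}_{\sup}:=\int_{\mathbb{R}^2} \frac{|\phi(t_1,t_2)|}{|t_1t_2|^{2\alpha+2-\frac1p}}\left(\sup_{(y_1,y_2)\in\mathbb{R}^2}\frac{v(t_1y_1,t_2y_2)}{v(y_1,y_2)}\right)^{1/p}dt_1dt_2 .$$ Then the operator $\mathscr{H}_{\alpha,\phi}:L^p_v(\mathbb{R}^2)\to L^p_v(\mathbb{R}^2)$ is bounded if and only if $\mathscr{A}_{\sup}<\infty$, and moreover the following estimates hold: $$\frac1c \mathscr{A}_{\sup}\le \|\mathscr{H}_{\alpha,\phi}\|_{L^p_v(\mathbb{R}^2)\to L^p_v(\mathbb{R}^2)}\le \mathscr{A}_{\sup}.$$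
   Context: A weight function is a function which is measurable, positive and finite almost everywhere on its domain. $L^p_v(\mathbb{R}^2)$ is the weighted Lebesgue space with norm $\|f\|_{L^p_v(\mathbb{R}^2)}=\left(\int_{\mathbb{R}^2}|f(x_1,x_2)|^p v(x_1,x_2)\,dx_1dx_2\right)^{1/p}$. For a real parameter $\alpha$ and $\phi\in L^1(\mathbb{R}^2)$, the two dimensional Dunkl-Hausdorff operator is $$\mathscr{H}_{\alpha,\phi}f(x_1,x_2)=\int_{\mathbb{R}^2}\frac{|\phi(t_1,t_2)|}{|t_1t_2|^{2\alpha+2}}f\left(\frac{x_1}{t_1},\frac{x_2}{t_2}\right)dt_1dt_2 ,$$ and $\|\mathscr{H}_{\alpha,\phi}\|_{L^p_v(\mathbb{R}^2)\to L^p_v(\mathbb{R}^2)}$ denotes its operator norm. *)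

theory Defs
  imports "HOL-Analysis.Analysis"
begin

text \<open>Real powers on \<open>[0, \<infinity>]\<close>; only positive exponents \<open>a\<close> are used below, hence
  \<open>\<infinity>\<close> to the power \<open>a\<close> is \<open>\<infinity>\<close>.\<close>

definition ennreal_powr :: "ennreal \<Rightarrow> real \<Rightarrow> ennreal" where
  "ennreal_powr x a = (if x = \<infinity> then \<infinity> else ennreal (enn2real x powr a))"

text \<open>Weights are \<open>[0, \<infinity>]\<close>-valued, so that singular ones such as negative powers of
  the norm are covered; the values \<open>0\<close> and \<open>\<infinity>\<close> may occur on a null set.\<close>

definition weight :: "(real \<times> real \<Rightarrow> ennreal) \<Rightarrow> bool" where
  "weight v \<longleftrightarrow> v \<in> borel_measurable lebesgue \<and> (AE x in lebesgue. 0 < v x \<and> v x < \<infinity>)"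

definition Lp_norm :: "real \<Rightarrow> (real \<times> real \<Rightarrow> ennreal) \<Rightarrow> (real \<times> real \<Rightarrow> real) \<Rightarrow> ennreal" where
  "Lp_norm p v f = ennreal_powr (\<integral>\<^sup>+ x. ennreal (\<bar>f x\<bar> powr p) * v x \<partial>lebesgue) (1 / p)"

definition Lp_space :: "real \<Rightarrow> (real \<times> real \<Rightarrow> ennreal) \<Rightarrow> (real \<times> real \<Rightarrow> real) set" where
  "Lp_space p v = {f \<in> borel_measurable lebesgue. Lp_norm p v f < \<infinity>}"

text \<open>\<open>C\<close> is a bound for the operator \<open>T\<close> with domain of definition \<open>D\<close>, regarded as a map
  from \<open>L\<^sup>p\<close> with weight \<open>v\<close> to itself. In particular \<open>T\<close> must be defined on the whole space.\<close>

definition operator_bound ::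
  "(real \<times> real \<Rightarrow> real) set \<Rightarrow> ((real \<times> real \<Rightarrow> real) \<Rightarrow> real \<times> real \<Rightarrow> real)
    \<Rightarrow> real \<Rightarrow> (real \<times> real \<Rightarrow> ennreal) \<Rightarrow> real \<Rightarrow> bool" where
  "operator_bound D T p v C \<longleftrightarrow> 0 \<le> C \<and> Lp_space p v \<subseteq> D \<and>
    (\<forall>f \<in> Lp_space p v. T f \<in> Lp_space p v \<and> Lp_norm p v (T f) \<le> ennreal C * Lp_norm p v f)"

definition operator_bounded ::
  "(real \<times> real \<Rightarrow> real) set \<Rightarrow> ((real \<times> real \<Rightarrow> real) \<Rightarrow> real \<times> real \<Rightarrow> real)
    \<Rightarrow> real \<Rightarrow> (real \<times> real \<Rightarrow> ennreal) \<Rightarrow> bool" where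
  "operator_bounded D T p v \<longleftrightarrow> (\<exists>C. operator_bound D T p v C)"

text \<open>The operator norm is \<open>\<infinity>\<close> if the operator is not bounded (infimum of the empty set).\<close>

definition operator_norm ::
  "(real \<times> real \<Rightarrow> real) set \<Rightarrow> ((real \<times> real \<Rightarrow> real) \<Rightarrow> real \<times> real \<Rightarrow> real)
    \<Rightarrow> real \<Rightarrow> (real \<times> real \<Rightarrow> ennreal) \<Rightarrow> ennreal" where
  "operator_norm D T p v = (INF C \<in> {C. operator_bound D T p v C}. ennreal C)"

definition dunkl_hausdorff_integrand ::
  "real \<Rightarrow> (real \<times> real \<Rightarrow> real) \<Rightarrow> (real \<times> real \<Rightarrow> real) \<Rightarrow> real \<times> real \<Rightarrow> real \<times> real \<Rightarrow> real" where
  "dunkl_hausdorff_integrand \<alpha> \<phi> f x t =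
    \<bar>\<phi> t\<bar> / \<bar>fst t * snd t\<bar> powr (2 * \<alpha> + 2) * f (fst x / fst t, snd x / snd t)"

definition dunkl_hausdorff ::
  "real \<Rightarrow> (real \<times> real \<Rightarrow> real) \<Rightarrow> (real \<times> real \<Rightarrow> real) \<Rightarrow> real \<times> real \<Rightarrow> real" where
  "dunkl_hausdorff \<alpha> \<phi> f x = integral\<^sup>L lebesgue (dunkl_hausdorff_integrand \<alpha> \<phi> f x)"

text \<open>Since the Bochner integral of a non-integrable function is \<open>0\<close> by convention, convergence
  of the defining integral almost everywhere is required explicitly.\<close>

definition dunkl_hausdorff_dom ::
  "real \<Rightarrow> (real \<times> real \<Rightarrow> real) \<Rightarrow> (real \<times> real \<Rightarrow> real) set" where
  "dunkl_hausdorff_dom \<alpha> \<phi> =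
    {f. AE x in lebesgue. integrable lebesgue (dunkl_hausdorff_integrand \<alpha> \<phi> f x)}"

definition scale :: "real \<times> real \<Rightarrow> real \<times> real \<Rightarrow> real \<times> real" where
  "scale t y = (fst t * fst y, snd t * snd y)"

text \<open>The points \<open>y\<close> at which \<open>v (scale t y) / v y\<close> is a quotient of positive finite numbers.
  If \<open>v\<close> is a weight and both entries of \<open>t\<close> are nonzero, this is almost all of the plane. A power weight
  such as \<open>\<bar>y\<^sub>1\<bar>\<close> shows that the exceptional points have to be left out: there the quotient
  may be \<open>0 / 0\<close>, which is \<open>0\<close> in type \<^typ>\<open>ennreal\<close>.\<close>

definition ratio_dom :: "(real \<times> real \<Rightarrow> ennreal) \<Rightarrow> real \<times> real \<Rightarrow> (real \<times> real) set" where
  "ratio_dom v t = {y. 0 < v y \<and> v y < \<infinity> \<and> 0 < v (scale t y) \<and> v (scale t y) < \<infinity>}"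

definition ratio_sup :: "(real \<times> real \<Rightarrow> ennreal) \<Rightarrow> real \<times> real \<Rightarrow> ennreal" where
  "ratio_sup v t = (SUP y \<in> ratio_dom v t. v (scale t y) / v y)"

definition ratio_inf :: "(real \<times> real \<Rightarrow> ennreal) \<Rightarrow> real \<times> real \<Rightarrow> ennreal" where
  "ratio_inf v t = (INF y \<in> ratio_dom v t. v (scale t y) / v y)"

definition A_sup ::
  "real \<Rightarrow> (real \<times> real \<Rightarrow> real) \<Rightarrow> real \<Rightarrow> (real \<times> real \<Rightarrow> ennreal) \<Rightarrow> ennreal" where
  "A_sup \<alpha> \<phi> p v =
    (\<integral>\<^sup>+ t. ennreal (\<bar>\<phi> t\<bar> / \<bar>fst t * snd t\<bar> powr (2 * \<alpha> + 2 - 1 / p))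
            * ennreal_powr (ratio_sup v t) (1 / p) \<partial>lebesgue)"

end

theory Submission
  imports Defs
begin

text \<open>
  The dilation \<open>f \<mapsto> f (x\<^sub>1/t\<^sub>1, x\<^sub>2/t\<^sub>2)\<close> multiplies the \<open>p\<close>-th power of the weighted norm by a number
  between \<open>\<bar>t\<^sub>1 t\<^sub>2\<bar> * m t\<close> and \<open>\<bar>t\<^sub>1 t\<^sub>2\<bar> * M t\<close>, where \<open>m t\<close> and \<open>M t\<close> are the essential infimum and
  supremum over \<open>y\<close> of \<open>v (scale t y) / v y\<close>. The operator is a superposition of dilations with
  nonnegative coefficients \<open>q t = \<bar>\<phi> t\<bar> / \<bar>t\<^sub>1 t\<^sub>2\<bar> powr (2 \<alpha> + 2)\<close>. Its norm is therefore at most the integral of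
  \<open>q t * (\<bar>t\<^sub>1 t\<^sub>2\<bar> * M t) powr (1/p)\<close> (\<open>hausdorff_upper\<close>, from Hoelder's inequality and Fubini's theorem).
  It is at least the integral of \<open>q t * (\<bar>t\<^sub>1 t\<^sub>2\<bar> * m t) powr (1/p)\<close> (\<open>hausdorff_lower\<close>), because the one
  function \<open>(v x * \<bar>x\<^sub>1 x\<^sub>2\<bar>) powr (- 1/p)\<close> is multiplied by at least \<open>(\<bar>t\<^sub>1 t\<^sub>2\<bar> * m t) powr (1/p)\<close> under every
  dilation. That function has infinite norm and is cut off to a large square in logarithmic
  coordinates; the loss is negligible, since the area of a large square hardly changes, in
  proportion, when its sides change by a bounded amount.

  It remains to compare the two integrals with \<open>A_sup\<close>. The pointwise supremum \<open>ratio_sup v t\<close> is at least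
  \<open>M t\<close>, and by hypothesis it is at most \<open>c\<close> times \<open>ratio_inf v t\<close>, hence at most \<open>c * m t\<close>; taking \<open>p\<close>-th
  roots costs the factor \<open>c powr (1/p)\<close>, which is at most \<open>c\<close>. Since \<open>ratio_sup v\<close> may fail to be
  measurable, the integral defining \<open>A_sup\<close> is a lower integral. The functions \<open>m\<close> and \<open>M\<close> are
  Borel (\<open>dilation_multipliers\<close>), and monotonicity suffices to compare their integrals with the lower one.

  The theorems on iterated integrals need Borel functions instead of Lebesgue measurable ones. Hence \<open>v\<close>, \<open>\<phi>\<close>
  and \<open>f\<close> are replaced by Borel representatives, which is harmless since dilations with nonzero
  entries preserve null sets (\<open>dunkl_hausdorff_representation\<close>).
\<close>

section \<open>Extended nonnegative reals\<close>

lemma ennreal_powr_ennreal: "0 \<le> r \<Longrightarrow> ennreal_powr (ennreal r) a = ennreal (r powr a)"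
  by (simp add: ennreal_powr_def)

lemma ennreal_powr_mono:
  assumes "0 \<le> a" "x \<le> y"
  shows "ennreal_powr x a \<le> ennreal_powr y a"
  using assms
  by (cases x; cases y) (auto simp: ennreal_powr_def top_unique intro!: powr_mono2)

lemma ennreal_powr_cancel:
  assumes "a \<noteq> 0"
  shows "ennreal_powr (ennreal_powr x a) (1 / a) = x" "ennreal_powr (ennreal_powr x (1 / a)) a = x"
  using assms by (cases x; simp add: ennreal_powr_def powr_powr)+

lemma ennreal_powr_mult:
  assumes "0 < a"
  shows "ennreal_powr (x * y) a = ennreal_powr x a * ennreal_powr y a"
proof (cases "x = \<infinity> \<or> y = \<infinity>")
  case True
  then show ?thesis
    using assms by (auto simp: ennreal_powr_def ennreal_top_mult ennreal_mult_top enn2real_eq_0_iff)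
next
  case False
  then show ?thesis
    by (cases x; cases y) (auto simp: ennreal_powr_ennreal powr_mult simp flip: ennreal_mult)
qed

lemma ennreal_powr_less_top_iff: "ennreal_powr x a < top \<longleftrightarrow> x < top"
  by (cases x) (auto simp: ennreal_powr_def)

lemma borel_measurable_ennreal_powr [measurable]:
  assumes [measurable]: "f \<in> borel_measurable M"
  shows "(\<lambda>x. ennreal_powr (f x) a) \<in> borel_measurable M"
  unfolding ennreal_powr_def by measurable

lemma ennreal_inverse_antimono:
  fixes x y :: ennreal
  assumes "x \<le> y"
  shows "inverse y \<le> inverse x"
proof (cases "x = 0 \<or> y = \<infinity>")
  case False
  with assms show ?thesis
    by (cases x; cases y) (auto simp: inverse_ennreal less_le top_unique)
qed auto

section \<open>Dilations of the plane\<close>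

lemma borel_measurable_coordinates [measurable]:
  "fst \<in> borel_measurable (borel :: (real \<times> real) measure)"
  "snd \<in> borel_measurable (borel :: (real \<times> real) measure)"
  unfolding borel_prod[symmetric] by measurable

lemma scale_measurable [measurable (raw)]:
  assumes [measurable]: "f \<in> borel_measurable M" "g \<in> borel_measurable M"
  shows "(\<lambda>x. scale (f x) (g x)) \<in> borel_measurable M"
  unfolding scale_def by measurable

definition off_axes :: "real \<times> real \<Rightarrow> bool" where
  "off_axes t \<longleftrightarrow> fst t \<noteq> 0 \<and> snd t \<noteq> 0"

definition coord_inverse :: "real \<times> real \<Rightarrow> real \<times> real" where
  "coord_inverse t = (1 / fst t, 1 / snd t)"

lemma coord_inverse_measurable [measurable]: "coord_inverse \<in> borel_measurable borel"
  unfolding coord_inverse_def by measurable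

lemma off_axes_measurable [measurable]: "Measurable.pred borel off_axes"
  unfolding off_axes_def by measurable

lemma off_axes_coord_inverse: "off_axes (coord_inverse t) \<longleftrightarrow> off_axes t"
  by (simp add: off_axes_def coord_inverse_def)

lemma scale_coord_inverse:
  assumes "off_axes t"
  shows "scale t (scale (coord_inverse t) x) = x" "scale (coord_inverse t) (scale t x) = x"
  using assms by (auto simp: scale_def coord_inverse_def off_axes_def)

lemma AE_off_axes: "AE t in lborel. off_axes t"
proof -
  have "AE s in lborel. AE t in lborel. off_axes (s, t)"
    using AE_lborel_singleton[of "0::real"]
    by eventually_elim (use AE_lborel_singleton[of "0::real"] in \<open>auto simp: off_axes_def\<close>)
  then show ?thesis
    using lborel_pair.AE_pair_measure[of off_axes, unfolded lborel_prod] by simp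
qed

text \<open>The Jacobian of the diagonal linear map \<open>scale t\<close>, obtained from the one-dimensional
  substitution rule in each coordinate.\<close>

lemma nn_integral_scale:
  fixes f :: "real \<times> real \<Rightarrow> ennreal"
  assumes [measurable]: "f \<in> borel_measurable borel" and t: "off_axes t"
  shows "(\<integral>\<^sup>+ x. f x \<partial>lborel) = ennreal \<bar>fst t * snd t\<bar> * (\<integral>\<^sup>+ y. f (scale t y) \<partial>lborel)"
proof -
  have [measurable]: "f \<in> borel_measurable (borel \<Otimes>\<^sub>M borel)"
    by (simp add: borel_prod)
  have "(\<integral>\<^sup>+ x. f x \<partial>lborel) = (\<integral>\<^sup>+ r. \<integral>\<^sup>+ s. f (r, s) \<partial>lborel \<partial>lborel)"
    unfolding lborel_prod[symmetric] by (intro lborel.nn_integral_fst[symmetric]) simp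
  also have "\<dots> = ennreal \<bar>fst t\<bar> * (\<integral>\<^sup>+ r. \<integral>\<^sup>+ s. f (fst t * r, s) \<partial>lborel \<partial>lborel)"
    using t by (subst nn_integral_real_affine[where c = "fst t" and t = 0]) (auto simp: off_axes_def)
  also have "(\<lambda>r. \<integral>\<^sup>+ s. f (fst t * r, s) \<partial>lborel)
      = (\<lambda>r. ennreal \<bar>snd t\<bar> * (\<integral>\<^sup>+ s. f (fst t * r, snd t * s) \<partial>lborel))"
    using t by (intro ext, subst nn_integral_real_affine[where c = "snd t" and t = 0])
      (auto simp: off_axes_def)
  also have "ennreal \<bar>fst t\<bar> * (\<integral>\<^sup>+ r. ennreal \<bar>snd t\<bar> * (\<integral>\<^sup>+ s. f (fst t * r, snd t * s) \<partial>lborel) \<partial>lborel)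
      = ennreal \<bar>fst t * snd t\<bar> * (\<integral>\<^sup>+ r. \<integral>\<^sup>+ s. f (scale t (r, s)) \<partial>lborel \<partial>lborel)"
    by (subst nn_integral_cmult) (auto simp: abs_mult ennreal_mult mult.assoc scale_def)
  also have "(\<integral>\<^sup>+ r. \<integral>\<^sup>+ s. f (scale t (r, s)) \<partial>lborel \<partial>lborel) = (\<integral>\<^sup>+ y. f (scale t y) \<partial>lborel)"
    unfolding lborel_prod[symmetric]
    by (intro lborel.nn_integral_fst) (simp add: lborel_prod)
  finally show ?thesis .
qed

lemma AE_scale:
  assumes P: "AE x in lborel. P x" and t: "off_axes t"
  shows "AE y in lborel. P (scale t y)"
proof -
  obtain N where N: "\<And>x. x \<in> space lborel - N \<Longrightarrow> P x" "N \<in> null_sets lborel"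
    by (rule AE_E3[OF P]) blast
  have [measurable]: "N \<in> sets borel"
    using null_setsD2[OF N(2)] by simp
  let ?I = "indicator N :: real \<times> real \<Rightarrow> ennreal"
  have "0 = (\<integral>\<^sup>+ x. ?I x \<partial>lborel)"
    using null_setsD1[OF N(2)] by simp
  also have "\<dots> = ennreal \<bar>fst t * snd t\<bar> * (\<integral>\<^sup>+ y. ?I (scale t y) \<partial>lborel)"
    by (rule nn_integral_scale[OF _ t]) measurable
  finally have "(\<integral>\<^sup>+ y. ?I (scale t y) \<partial>lborel) = 0"
    using t by (simp add: off_axes_def)
  moreover have "(\<lambda>y. ?I (scale t y)) \<in> borel_measurable lborel"
    by measurable
  ultimately have "AE y in lborel. ?I (scale t y) = 0"
    using nn_integral_0_iff_AE by blast
  then show ?thesis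
    by eventually_elim (use N(1) in \<open>simp add: indicator_eq_0_iff\<close>)
qed

text \<open>Substitution gives facts for each fixed dilation \<open>t\<close> and almost every \<open>x\<close>, whereas the Hausdorff
  integral runs over \<open>t\<close> for fixed \<open>x\<close>; Fubini's theorem exchanges the two.\<close>

lemma AE_swap_off_axes:
  fixes P :: "real \<times> real \<Rightarrow> real \<times> real \<Rightarrow> bool"
  assumes P [measurable]: "Measurable.pred (lborel \<Otimes>\<^sub>M lborel) (\<lambda>z. P (fst z) (snd z))"
    and AE: "\<And>t. off_axes t \<Longrightarrow> AE x in lborel. P x t"
  shows "AE x in lborel. AE t in lborel. off_axes t \<and> P x t"
proof (subst lborel_pair.AE_commute)
  have "Measurable.pred (lborel \<Otimes>\<^sub>M lborel)
      (\<lambda>z :: (real \<times> real) \<times> (real \<times> real). off_axes (snd z) \<and> P (fst z) (snd z))"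
    by measurable
  then show "{z \<in> space (lborel \<Otimes>\<^sub>M lborel). off_axes (snd z) \<and> P (fst z) (snd z)}
      \<in> sets (lborel \<Otimes>\<^sub>M lborel)"
    by (rule predE)
  show "AE t in lborel. AE x in lborel. off_axes t \<and> P x t"
    using AE_off_axes by eventually_elim (simp add: AE)
qed

text \<open>This makes the Hausdorff integral at almost every point independent of the representative
  of the function it is applied to. Null sets are preserved by each single dilation, and the
  exceptional sets are combined by Fubini.\<close>

lemma AE_dilated_argument:
  assumes "AE y in lborel. P y"
  shows "AE x in lborel. AE t in lborel. P (scale (coord_inverse t) x)"
proof -
  obtain N where N: "\<And>x. x \<in> space lborel - N \<Longrightarrow> P x" "N \<in> null_sets lborel"
    by (rule AE_E3[OF assms]) blast
  have [measurable]: "N \<in> sets borel"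
    using null_setsD2[OF N(2)] by simp
  have "AE x in lborel. AE t in lborel. off_axes t \<and> scale (coord_inverse t) x \<notin> N"
  proof (rule AE_swap_off_axes)
    fix t :: "real \<times> real" assume "off_axes t"
    then show "AE x in lborel. scale (coord_inverse t) x \<notin> N"
      using AE_scale[OF AE_not_in[OF N(2)], of "coord_inverse t"] by (simp add: off_axes_coord_inverse)
  qed measurable
  then show ?thesis
    by (rule eventually_mono) (erule eventually_mono, use N(1) in simp)
qed

section \<open>Essential suprema depending on a parameter\<close>

text \<open>The supremum of an uncountable family of measurable functions need not be measurable, but
  the essential supremum over one variable is a measurable function of the other: for each
  rational \<open>q\<close> Fubini's theorem makes the measure of a section of \<open>{q < F}\<close> measurable, and the
  essential supremum is the infimum of the countably many \<open>q\<close> whose section is null.\<close>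

lemma parametric_ess_sup:
  fixes F :: "'a \<Rightarrow> 'b \<Rightarrow> ennreal"
  assumes "sigma_finite_measure N"
    and F [measurable]: "case_prod F \<in> borel_measurable (L \<Otimes>\<^sub>M N)"
  obtains M where "M \<in> borel_measurable L"
    and "\<And>t. t \<in> space L \<Longrightarrow> AE y in N. F t y \<le> M t"
    and "\<And>t b. t \<in> space L \<Longrightarrow> AE y in N. F t y \<le> b \<Longrightarrow> M t \<le> b"
proof -
  interpret sigma_finite_measure N by fact
  \<comment> \<open>\<open>G q t\<close> is \<open>q\<close> if \<open>q\<close> is an essential upper bound of \<open>F t\<close>, and the trivial bound otherwise.\<close>
  define E where "E q = {z \<in> space (L \<Otimes>\<^sub>M N). ennreal q < case_prod F z}" for q
  have E [measurable]: "E q \<in> sets (L \<Otimes>\<^sub>M N)" for q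
    unfolding E_def by measurable
  define G where "G q t = (if emeasure N (Pair t -` E q) = 0 then ennreal q else \<infinity>)" for q t
  have [measurable]: "G q \<in> borel_measurable L" for q
    unfolding G_def using measurable_emeasure_Pair[OF E] by measurable
  have G: "emeasure N (Pair t -` E q) = 0 \<longleftrightarrow> (AE y in N. F t y \<le> ennreal q)" if "t \<in> space L" for q t
  proof (rule AE_iff_measurable[symmetric])
    show "Pair t -` E q \<in> sets N" by measurable
    show "{y \<in> space N. \<not> F t y \<le> ennreal q} = Pair t -` E q"
      using that by (auto simp: E_def space_pair_measure)
  qed
  show thesis
  proof (rule that[of "\<lambda>t. INF q\<in>\<rat>. G q t"])
    show "(\<lambda>t. INF q\<in>\<rat>. G q t) \<in> borel_measurable L"
      by (intro borel_measurable_INF countable_rat) measurable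
    fix t assume t: "t \<in> space L"
    have "AE y in N. F t y \<le> G q t" for q
      using G[OF t, of q] by (auto simp: G_def)
    then have "AE y in N. \<forall>q\<in>\<rat>. F t y \<le> G q t"
      by (subst AE_ball_countable) (auto simp: countable_rat)
    then show "AE y in N. F t y \<le> (INF q\<in>\<rat>. G q t)"
      by eventually_elim (auto intro: INF_greatest)
    fix b assume b: "AE y in N. F t y \<le> b"
    show "(INF q\<in>\<rat>. G q t) \<le> b"
    proof (rule ccontr)
      assume "\<not> ?thesis"
      then obtain r where r: "r \<in> \<rat>" "b < ennreal r" "ennreal r < (INF q\<in>\<rat>. G q t)"
        using ennreal_rat_dense[of b "INF q\<in>\<rat>. G q t"] by (auto simp: not_le Rats_def)
      have "AE y in N. F t y \<le> ennreal r"
        using b by eventually_elim (use r in auto)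
      then have "G r t = ennreal r"
        using G[OF t] by (simp add: G_def)
      with r show False
        by (metis INF_lower leD)
    qed
  qed
qed

section \<open>Hoelder's inequality\<close>

text \<open>Weighted arithmetic-geometric mean inequality for \<open>s powr (1 - p) * g powr p\<close> and \<open>s\<close> with weights
  \<open>1/p\<close> and \<open>1 - 1/p\<close>. The right-hand side is affine in \<open>g powr p\<close>, so it can be integrated, and \<open>s\<close> is
  free to be optimised afterwards; equality holds for \<open>s = g\<close>.\<close>

lemma young_tangent:
  fixes g s p :: real
  assumes p: "1 < p" and g: "0 \<le> g" and s: "0 < s"
  shows "g \<le> s powr (1 - p) / p * g powr p + (1 - 1 / p) * s"
proof (cases "g = 0")
  case True
  then show ?thesis using p s by simp
next
  case False
  with g have g: "0 < g" by simp
  have "(s powr (1 - p) * g powr p) powr (1 / p) * s powr (1 - 1 / p)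
     \<le> 1 / p * (s powr (1 - p) * g powr p) + (1 - 1 / p) * s"
    using p g s by (intro Youngs_inequality_0) auto
  moreover have "(s powr (1 - p) * g powr p) powr (1 / p) * s powr (1 - 1 / p)
      = g * (s powr ((1 - p) / p) * s powr (1 - 1 / p))"
    using p g s by (simp add: powr_mult powr_powr)
  moreover have "s powr ((1 - p) / p) * s powr (1 - 1 / p) = 1"
    using p s by (simp add: powr_add[symmetric] diff_divide_distrib)
  ultimately show ?thesis by simp
qed

text \<open>Hoelder's inequality with respect to the finite measure of density \<open>K\<close>, also when
  \<open>g\<close> has infinite norm. It follows by integrating the tangent inequality with the optimal
  \<open>s\<close>, which is the \<open>L\<^sup>p\<close> mean of \<open>g\<close>.\<close>

lemma Holder_weighted:
  fixes K g :: "'a \<Rightarrow> real"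
  assumes p: "1 < p"
    and [measurable]: "K \<in> borel_measurable M" "g \<in> borel_measurable M"
    and K: "\<And>t. 0 \<le> K t" and g: "\<And>t. 0 \<le> g t"
    and A: "(\<integral>\<^sup>+ t. ennreal (K t) \<partial>M) = ennreal A" and A0: "0 \<le> A"
  shows "ennreal_powr (\<integral>\<^sup>+ t. ennreal (K t * g t) \<partial>M) p
    \<le> ennreal (A powr (p - 1)) * (\<integral>\<^sup>+ t. ennreal (K t * g t powr p) \<partial>M)"
proof -
  let ?I = "\<integral>\<^sup>+ t. ennreal (K t * g t) \<partial>M" and ?J = "\<integral>\<^sup>+ t. ennreal (K t * g t powr p) \<partial>M"
  have zero: ?thesis if "AE t in M. K t * g t = 0"
  proof -
    have "?I = 0"
      using that by (subst nn_integral_0_iff_AE) auto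
    then show ?thesis using p by (simp add: ennreal_powr_def)
  qed
  \<comment> \<open>The optimal \<open>s\<close> exists only if both integrals are positive and finite; otherwise the claim is trivial.\<close>
  consider "A = 0" | "?J = 0" | "0 < A" "?J = \<infinity>" | B where "0 < A" "0 < B" "?J = ennreal B"
    using A0 by (cases ?J) (force simp: less_le)+
  then show ?thesis
  proof cases
    case 1
    then have "AE t in M. K t \<le> 0"
      using A nn_integral_0_iff_AE[of "\<lambda>t. ennreal (K t)" M] by (simp add: order.antisym ennreal_eq_0_iff)
    then have "AE t in M. K t = 0"
      by eventually_elim (use K in \<open>simp add: order.antisym\<close>)
    then show ?thesis
      by (intro zero) auto
  next
    case 2
    then have "AE t in M. K t * g t powr p \<le> 0"
      using nn_integral_0_iff_AE[of "\<lambda>t. ennreal (K t * g t powr p)" M] by (simp add: ennreal_eq_0_iff)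
    then have "AE t in M. K t * g t = 0"
      by eventually_elim (use K in \<open>auto simp: mult_le_0_iff intro: order.antisym\<close>)
    then show ?thesis
      by (rule zero)
  next
    case 3
    then show ?thesis by (simp add: ennreal_mult_top)
  next
    case (4 B)
    define s where "s = (B / A) powr (1 / p)"
    have s: "0 < s" using 4 by (simp add: s_def)
    have pt: "K t * g t \<le> s powr (1 - p) / p * (K t * g t powr p) + (1 - 1 / p) * s * K t" for t
      using mult_left_mono[OF young_tangent[OF p g[of t] s] K[of t]] by (simp add: algebra_simps)
    have "?I \<le> (\<integral>\<^sup>+ t. ennreal (s powr (1 - p) / p) * ennreal (K t * g t powr p)
        + ennreal ((1 - 1 / p) * s) * ennreal (K t) \<partial>M)"
      using pt p s K by (intro nn_integral_mono)
        (auto simp: ennreal_mult[symmetric] ennreal_plus[symmetric] simp del: ennreal_plus intro!: ennreal_leI)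
    also have "\<dots> = ennreal (s powr (1 - p) / p) * ?J + ennreal ((1 - 1 / p) * s) * ennreal A"
      by (subst nn_integral_add) (auto simp: nn_integral_cmult A)
    also have "\<dots> = ennreal (s powr (1 - p) / p * B + (1 - 1 / p) * s * A)"
      using 4 p s by (simp add: ennreal_mult[symmetric] ennreal_plus[symmetric] del: ennreal_plus)
    also have "s powr (1 - p) / p * B + (1 - 1 / p) * s * A = s * A"
    proof -
      have "s powr p = B / A" using 4 p by (simp add: s_def powr_powr)
      then have "s powr (1 - p) * B = s * A"
        using 4 s by (simp add: powr_diff field_simps)
      then show ?thesis using p by (simp add: field_simps)
    qed
    finally have "ennreal_powr ?I p \<le> ennreal ((s * A) powr p)"
      using ennreal_powr_mono[of p ?I "ennreal (s * A)"] p s 4 by (simp add: ennreal_powr_ennreal)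
    also have "(s * A) powr p = A powr (p - 1) * B"
      using 4 p by (simp add: powr_mult s_def powr_powr powr_diff)
    finally show ?thesis
      using 4 by (simp add: ennreal_mult)
  qed
qed

section \<open>Dilation ratios of a weight\<close>

text \<open>After a change on a null set a weight is Borel, finite and positive at every point, so that
  quotients of its values can be taken in the reals.\<close>

lemma weight_representative:
  assumes "weight v"
  obtains u :: "real \<times> real \<Rightarrow> real" where "u \<in> borel_measurable borel" "\<And>x. 0 < u x"
    "AE x in lborel. v x = ennreal (u x)"
proof -
  obtain w where w [measurable]: "w \<in> borel_measurable lborel" and eq: "AE x in lborel. v x = w x"
    using assms completion_ex_borel_measurable[of v lborel] by (auto simp: weight_def)
  define u where "u x = (if 0 < w x \<and> w x < \<infinity> then enn2real (w x) else 1)" for x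
  show thesis
  proof
    show "u \<in> borel_measurable borel"
      using w unfolding u_def by measurable
    show "0 < u x" for x
      by (auto simp: u_def enn2real_positive_iff)
    have "AE x in lborel. 0 < v x \<and> v x < \<infinity>"
      using assms by (simp add: weight_def AE_completion_iff)
    with eq show "AE x in lborel. v x = ennreal (u x)"
      by eventually_elim (auto simp: u_def)
  qed
qed

lemma AE_lborel_witness:
  fixes P :: "'a::euclidean_space \<Rightarrow> bool"
  assumes "AE x in lborel. P x"
  obtains x where "P x"
proof -
  have "\<not> (AE x::'a in lborel. False)"
    using emeasure_lborel_UNIV[where 'a = 'a] by (simp add: ae_filter_eq_bot_iff trivial_limit_def[symmetric])
  then show thesis
    using assms that by (metis (mono_tags, lifting) eventually_mono)
qed

lemma AE_ratio:
  assumes t: "off_axes t" and u: "\<And>x. 0 < u x" and v: "AE x in lborel. v x = ennreal (u x)"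
  shows "AE y in lborel. y \<in> ratio_dom v t \<and> v (scale t y) / v y = ennreal (u (scale t y) / u y)"
  using v AE_scale[OF v t]
  by eventually_elim (auto simp: ratio_dom_def u divide_ennreal less_imp_le)

lemma AE_ratio_bounds:
  assumes t: "off_axes t" and u: "\<And>x. 0 < u x" and v: "AE x in lborel. v x = ennreal (u x)"
  shows "AE y in lborel. ratio_inf v t \<le> ennreal (u (scale t y) / u y)
                       \<and> ennreal (u (scale t y) / u y) \<le> ratio_sup v t"
  using AE_ratio[OF assms]
proof eventually_elim
  case (elim y)
  then show ?case
    using INF_lower[of y "ratio_dom v t" "\<lambda>y. v (scale t y) / v y"]
      SUP_upper[of y "ratio_dom v t" "\<lambda>y. v (scale t y) / v y"]
    by (simp add: ratio_inf_def ratio_sup_def)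
qed

text \<open>For the trivial dilation all the ratios are \<open>1\<close>.\<close>

lemma comparison_constant_ge_1:
  assumes "weight v" and c: "ratio_sup v (1, 1) \<le> ennreal c * ratio_inf v (1, 1)"
  shows "1 \<le> c"
proof -
  have t: "off_axes (1, 1)" by (simp add: off_axes_def)
  obtain u where u: "\<And>x. 0 < u x" "AE x in lborel. v x = ennreal (u x)"
    using weight_representative[OF assms(1)] by metis
  obtain y where "ratio_inf v (1, 1) \<le> ennreal (u (scale (1, 1) y) / u y)"
      "ennreal (u (scale (1, 1) y) / u y) \<le> ratio_sup v (1, 1)"
    using AE_lborel_witness[OF AE_ratio_bounds[OF t u]] by metis
  moreover have "u (scale (1, 1) y) / u y = 1"
    using u(1)[of y] by (simp add: scale_def)
  ultimately have "ratio_inf v (1, 1) \<le> 1" "1 \<le> ratio_sup v (1, 1)"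
    by simp_all
  then have "1 \<le> ennreal c * 1"
    using c by (meson mult_left_mono order_trans zero_le)
  then show ?thesis
    by (simp add: ennreal_ge_1)
qed

text \<open>The functions \<open>m\<close> and \<open>M\<close> are the essential infimum and supremum over \<open>y\<close> of
  \<open>u (scale t y) / u y\<close>. They are measurable substitutes for \<open>ratio_inf v\<close> and \<open>ratio_sup v\<close>, which may fail
  to be measurable and also depend on the representative of \<open>v\<close>. The comparison
  between supremum and infimum serves to make \<open>M\<close> finite and \<open>m\<close> positive.\<close>

lemma dilation_multipliers:
  assumes "weight v"
    and c: "\<And>t. off_axes t \<Longrightarrow> ratio_sup v t \<le> ennreal c * ratio_inf v t"
  obtains u m M :: "real \<times> real \<Rightarrow> real"
  where "u \<in> borel_measurable borel" "m \<in> borel_measurable borel" "M \<in> borel_measurable borel"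
    and "\<And>x. 0 < u x" "AE x in lborel. v x = ennreal (u x)"
    and "\<And>t. off_axes t \<Longrightarrow> 0 < m t" "\<And>t. off_axes t \<Longrightarrow> 0 < M t"
    and "\<And>t. off_axes t \<Longrightarrow> AE y in lborel. m t * u y \<le> u (scale t y)"
    and "\<And>t. off_axes t \<Longrightarrow> AE y in lborel. u (scale t y) \<le> M t * u y"
    and "\<And>t. off_axes t \<Longrightarrow> ratio_inf v t \<le> ennreal (m t)"
    and "\<And>t. off_axes t \<Longrightarrow> ennreal (M t) \<le> ratio_sup v t"
proof -
  obtain u where [measurable]: "u \<in> borel_measurable borel" and u: "\<And>x. 0 < u x"
      and v: "AE x in lborel. v x = ennreal (u x)"
    using weight_representative[OF assms(1)] by metis
  have meas: "case_prod (\<lambda>t y. ennreal (u (scale t y) / u y)) \<in> borel_measurable (borel \<Otimes>\<^sub>M lborel)"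
    "case_prod (\<lambda>t y. ennreal (u y / u (scale t y))) \<in> borel_measurable (borel \<Otimes>\<^sub>M lborel)"
    by measurable
  obtain S where [measurable]: "S \<in> borel_measurable borel"
      and S: "\<And>t. AE y in lborel. ennreal (u (scale t y) / u y) \<le> S t"
      "\<And>t b. AE y in lborel. ennreal (u (scale t y) / u y) \<le> b \<Longrightarrow> S t \<le> b"
    by (rule parametric_ess_sup[OF sigma_finite_lborel meas(1)]) simp
  obtain W where [measurable]: "W \<in> borel_measurable borel"
      and W: "\<And>t. AE y in lborel. ennreal (u y / u (scale t y)) \<le> W t"
      "\<And>t b. AE y in lborel. ennreal (u y / u (scale t y)) \<le> b \<Longrightarrow> W t \<le> b"
    by (rule parametric_ess_sup[OF sigma_finite_lborel meas(2)]) simp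
  \<comment> \<open>The essential infimum of a positive function is the reciprocal of the essential supremum of its reciprocal.\<close>
  define M where "M t = enn2real (S t)" for t
  define m where "m t = 1 / enn2real (W t)" for t
  have flip: "ennreal (u y / u (scale t y)) = inverse (ennreal (u (scale t y) / u y))" for t y
    using u by (subst inverse_ennreal) auto
  have main: "0 < m t \<and> 0 < M t \<and> (AE y in lborel. m t * u y \<le> u (scale t y))
      \<and> (AE y in lborel. u (scale t y) \<le> M t * u y)
      \<and> ratio_inf v t \<le> ennreal (m t) \<and> ennreal (M t) \<le> ratio_sup v t" if t: "off_axes t" for t
  proof -
    note bounds = AE_ratio_bounds[OF t u v]
    have S_le: "S t \<le> ratio_sup v t"
      using bounds by (intro S(2)) (auto elim: eventually_mono)
    have W_le: "W t \<le> inverse (ratio_inf v t)"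
    proof (rule W(2))
      show "AE y in lborel. ennreal (u y / u (scale t y)) \<le> inverse (ratio_inf v t)"
        using bounds by eventually_elim (auto simp only: flip intro!: ennreal_inverse_antimono)
    qed
    have "AE y in lborel. ratio_inf v t \<le> ennreal (u (scale t y) / u y)
        \<and> ennreal (u (scale t y) / u y) \<le> ratio_sup v t
        \<and> ennreal (u (scale t y) / u y) \<le> S t \<and> ennreal (u y / u (scale t y)) \<le> W t"
      using bounds S(1)[of t] W(1)[of t] by eventually_elim auto
    then obtain y where y: "ratio_inf v t \<le> ennreal (u (scale t y) / u y)"
        "ennreal (u (scale t y) / u y) \<le> ratio_sup v t"
        "ennreal (u (scale t y) / u y) \<le> S t" "ennreal (u y / u (scale t y)) \<le> W t"
      by (rule AE_lborel_witness) auto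
    have pos: "0 < ennreal (u (scale t y) / u y)" "0 < ennreal (u y / u (scale t y))"
      using u by simp_all
    have "ratio_sup v t \<le> ennreal c * ennreal (u (scale t y) / u y)"
      using c[OF t] y(1) by (meson mult_left_mono order_trans zero_le)
    also have "\<dots> < \<infinity>" by (simp add: ennreal_mult_less_top)
    finally have "S t < \<infinity>" using S_le by simp
    moreover have "0 < S t" using y(3) pos by order
    ultimately have M: "S t = ennreal (M t)" "0 < M t"
      by (auto simp: M_def enn2real_positive_iff)
    have "0 < ratio_sup v t" using y(2) pos by order
    with c[OF t] have "0 < ennreal c * ratio_inf v t" by order
    then have inf: "0 < ratio_inf v t" "ratio_inf v t < \<infinity>"
      using y(1) by (auto simp: ennreal_zero_less_mult_iff intro: le_less_trans)
    then have "inverse (ratio_inf v t) \<noteq> \<infinity>"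
      by simp
    then have "inverse (ratio_inf v t) < \<infinity>"
      by (simp only: less_top infinity_ennreal_def)
    then have "W t < \<infinity>" using W_le by order
    moreover have "0 < W t" using y(4) pos by order
    ultimately have W': "W t = ennreal (1 / m t)" "0 < m t"
      by (auto simp: m_def enn2real_positive_iff)
    have "ratio_inf v t = inverse (inverse (ratio_inf v t))"
      using inf by (cases "ratio_inf v t") (auto simp: inverse_ennreal)
    also have "\<dots> \<le> inverse (W t)"
      using W_le by (rule ennreal_inverse_antimono)
    also have "\<dots> = ennreal (m t)"
      using W' by (simp add: inverse_ennreal)
    finally have 1: "ratio_inf v t \<le> ennreal (m t)" .
    have 2: "AE y in lborel. m t * u y \<le> u (scale t y)"
      using W(1)[of t]
    proof eventually_elim
      case (elim y)
      then have "u y / u (scale t y) \<le> 1 / m t"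
        using W' by (simp add: ennreal_le_iff)
      then show ?case using u[of "scale t y"] W'(2) by (simp add: field_simps)
    qed
    have 3: "AE y in lborel. u (scale t y) \<le> M t * u y"
      using S(1)[of t]
    proof eventually_elim
      case (elim y)
      then have "u (scale t y) / u y \<le> M t"
        using M by (simp add: ennreal_le_iff)
      then show ?case using u[of y] by (simp add: field_simps)
    qed
    show ?thesis using 1 2 3 M W' S_le by auto
  qed
  show thesis
  proof (rule that[of u m M])
    show "m \<in> borel_measurable borel" "M \<in> borel_measurable borel"
      unfolding m_def M_def by measurable
  qed (use u v main in auto)
qed

section \<open>Upper bound for nonnegative Hausdorff operators\<close>

text \<open>Taking values in \<open>[0, \<infinity>]\<close>, the operator is defined on all nonnegative measurable functions, so
  questions of convergence can be postponed.\<close>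

definition hausdorff :: "(real \<times> real \<Rightarrow> real) \<Rightarrow> (real \<times> real \<Rightarrow> real) \<Rightarrow> real \<times> real \<Rightarrow> ennreal" where
  "hausdorff q g x = (\<integral>\<^sup>+ t. ennreal (q t * g (scale (coord_inverse t) x)) \<partial>lborel)"

text \<open>Write the kernel as \<open>q t = K t * J t powr (- 1/p)\<close> with \<open>J t = \<bar>t\<^sub>1 t\<^sub>2\<bar> * M t\<close>, which bounds the \<open>p\<close>-th
  power of the norm of the dilation by \<open>t\<close>. Hoelder's inequality for the
  measure of density \<open>K\<close> and total mass \<open>A\<close> moves the power \<open>p\<close> inside the integral. After exchanging the
  integrals, the substitution \<open>x = scale t y\<close> produces a factor that cancels against \<open>1 / J t\<close>.
  The result is an instance of Minkowski's integral inequality.\<close>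

lemma hausdorff_upper:
  fixes q g u M :: "real \<times> real \<Rightarrow> real"
  assumes p: "1 < p"
    and [measurable]: "q \<in> borel_measurable borel" "g \<in> borel_measurable borel"
      "u \<in> borel_measurable borel" "M \<in> borel_measurable borel"
    and q: "\<And>t. 0 \<le> q t" and g: "\<And>x. 0 \<le> g x" and u: "\<And>x. 0 < u x"
    and M: "\<And>t. off_axes t \<Longrightarrow> 0 < M t"
    and uM: "\<And>t. off_axes t \<Longrightarrow> AE y in lborel. u (scale t y) \<le> M t * u y"
    and A: "(\<integral>\<^sup>+ t. ennreal (q t * (\<bar>fst t * snd t\<bar> * M t) powr (1 / p)) \<partial>lborel) = ennreal A"
    and A0: "0 \<le> A"
  shows "(\<integral>\<^sup>+ x. ennreal_powr (hausdorff q g x) p * ennreal (u x) \<partial>lborel)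
    \<le> ennreal (A powr p) * (\<integral>\<^sup>+ x. ennreal (g x powr p * u x) \<partial>lborel)"
proof -
  define J where "J t = \<bar>fst t * snd t\<bar> * M t" for t
  define K where "K t = q t * J t powr (1 / p)" for t
  define G where "G x t = g (scale (coord_inverse t) x) * J t powr (- 1 / p)" for x t
  have [measurable]: "J \<in> borel_measurable borel" "K \<in> borel_measurable borel" "G x \<in> borel_measurable borel" for x
    unfolding J_def K_def G_def by measurable
  have J: "0 < J t" if "off_axes t" for t
    using that M[OF that] by (auto simp: J_def off_axes_def)
  have KA: "(\<integral>\<^sup>+ t. ennreal (K t) \<partial>lborel) = ennreal A"
    using A by (simp add: K_def J_def)
  have H: "hausdorff q g x = (\<integral>\<^sup>+ t. ennreal (K t * G x t) \<partial>lborel)" for x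
    unfolding hausdorff_def
  proof (rule nn_integral_cong_AE)
    show "AE t in lborel. ennreal (q t * g (scale (coord_inverse t) x)) = ennreal (K t * G x t)"
      using AE_off_axes
      by eventually_elim (use J in \<open>force simp: K_def G_def powr_minus field_simps\<close>)
  qed
  define R where "R x t = ennreal (K t / J t) * ennreal (g (scale (coord_inverse t) x) powr p * u x)" for x t
  have [measurable]: "case_prod R \<in> borel_measurable (lborel \<Otimes>\<^sub>M lborel)"
    unfolding R_def by measurable
  have "(\<integral>\<^sup>+ x. ennreal_powr (hausdorff q g x) p * ennreal (u x) \<partial>lborel)
    \<le> (\<integral>\<^sup>+ x. ennreal (A powr (p - 1)) * (\<integral>\<^sup>+ t. R x t \<partial>lborel) \<partial>lborel)"
  proof (rule nn_integral_mono)
    fix x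
    have "ennreal_powr (hausdorff q g x) p
        \<le> ennreal (A powr (p - 1)) * (\<integral>\<^sup>+ t. ennreal (K t * G x t powr p) \<partial>lborel)"
      unfolding H
      by (rule Holder_weighted[OF p _ _ _ _ KA A0]) (auto simp: K_def G_def q g)
    then have "ennreal_powr (hausdorff q g x) p * ennreal (u x)
        \<le> ennreal (A powr (p - 1)) * (\<integral>\<^sup>+ t. ennreal (K t * G x t powr p) \<partial>lborel) * ennreal (u x)"
      by (rule mult_right_mono) simp
    also have "\<dots> = ennreal (A powr (p - 1)) * (\<integral>\<^sup>+ t. ennreal (K t * G x t powr p) * ennreal (u x) \<partial>lborel)"
      by (simp add: nn_integral_multc mult.assoc)
    also have "(\<integral>\<^sup>+ t. ennreal (K t * G x t powr p) * ennreal (u x) \<partial>lborel) = (\<integral>\<^sup>+ t. R x t \<partial>lborel)"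
    proof (rule nn_integral_cong_AE)
      show "AE t in lborel. ennreal (K t * G x t powr p) * ennreal (u x) = R x t"
        using AE_off_axes
      proof eventually_elim
        case (elim t)
        have "G x t powr p = g (scale (coord_inverse t) x) powr p / J t"
          using J[OF elim] p g by (simp add: G_def powr_mult powr_powr powr_minus_divide powr_divide)
        then show ?case
          using J[OF elim] q u[of x]
          by (simp add: R_def K_def less_imp_le flip: ennreal_mult)
      qed
    qed
    finally show "ennreal_powr (hausdorff q g x) p * ennreal (u x)
        \<le> ennreal (A powr (p - 1)) * (\<integral>\<^sup>+ t. R x t \<partial>lborel)" .
  qed
  also have "\<dots> = ennreal (A powr (p - 1)) * (\<integral>\<^sup>+ x. \<integral>\<^sup>+ t. R x t \<partial>lborel \<partial>lborel)"
    by (rule nn_integral_cmult) measurable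
  also have "(\<integral>\<^sup>+ x. \<integral>\<^sup>+ t. R x t \<partial>lborel \<partial>lborel) = (\<integral>\<^sup>+ t. \<integral>\<^sup>+ x. R x t \<partial>lborel \<partial>lborel)"
    by (rule lborel_pair.Fubini'[symmetric]) measurable
  also have "\<dots> \<le> (\<integral>\<^sup>+ t. ennreal (K t) * (\<integral>\<^sup>+ x. ennreal (g x powr p * u x) \<partial>lborel) \<partial>lborel)"
  proof (rule nn_integral_mono_AE)
    show "AE t in lborel. (\<integral>\<^sup>+ x. R x t \<partial>lborel)
        \<le> ennreal (K t) * (\<integral>\<^sup>+ x. ennreal (g x powr p * u x) \<partial>lborel)"
      using AE_off_axes
    proof eventually_elim
      case (elim t)
      have "(\<integral>\<^sup>+ x. R x t \<partial>lborel) = ennreal (K t / J t) *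
          (\<integral>\<^sup>+ x. ennreal (g (scale (coord_inverse t) x) powr p * u x) \<partial>lborel)"
        unfolding R_def by (rule nn_integral_cmult) measurable
      also have "(\<integral>\<^sup>+ x. ennreal (g (scale (coord_inverse t) x) powr p * u x) \<partial>lborel)
          = ennreal \<bar>fst t * snd t\<bar> * (\<integral>\<^sup>+ y. ennreal (g y powr p * u (scale t y)) \<partial>lborel)"
        by (subst nn_integral_scale[OF _ elim]) (auto simp: scale_coord_inverse elim)
      also have "(\<integral>\<^sup>+ y. ennreal (g y powr p * u (scale t y)) \<partial>lborel)
          \<le> (\<integral>\<^sup>+ y. ennreal (M t) * ennreal (g y powr p * u y) \<partial>lborel)"
      proof (rule nn_integral_mono_AE)
        show "AE y in lborel. ennreal (g y powr p * u (scale t y)) \<le> ennreal (M t) * ennreal (g y powr p * u y)"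
          using uM[OF elim]
        proof eventually_elim
          case (elim y)
          have "g y powr p * u (scale t y) \<le> g y powr p * (M t * u y)"
            using elim by (rule mult_left_mono) simp
          then show ?case
            using M[OF \<open>off_axes t\<close>] u[of y]
            by (simp add: ennreal_leI mult.left_commute less_imp_le flip: ennreal_mult)
        qed
      qed
      also have "\<dots> = ennreal (M t) * (\<integral>\<^sup>+ x. ennreal (g x powr p * u x) \<partial>lborel)"
        by (rule nn_integral_cmult) measurable
      finally have "(\<integral>\<^sup>+ x. R x t \<partial>lborel) \<le> ennreal (K t / J t) * (ennreal \<bar>fst t * snd t\<bar> *
          (ennreal (M t) * (\<integral>\<^sup>+ x. ennreal (g x powr p * u x) \<partial>lborel)))"
        by (simp add: mult_left_mono)
      also have "\<dots> = ennreal (K t / J t * (\<bar>fst t * snd t\<bar> * M t)) *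
          (\<integral>\<^sup>+ x. ennreal (g x powr p * u x) \<partial>lborel)"
      proof -
        have "0 \<le> K t / J t" "0 \<le> M t"
          using M[OF elim] J[OF elim] q by (auto simp: K_def)
        then show ?thesis
          by (simp only: ennreal_mult mult_nonneg_nonneg abs_ge_zero mult.assoc)
      qed
      also have "K t / J t * (\<bar>fst t * snd t\<bar> * M t) = K t"
        using J[OF elim] unfolding J_def[symmetric] by simp
      finally show ?case .
    qed
  qed
  also have "\<dots> = ennreal A * (\<integral>\<^sup>+ x. ennreal (g x powr p * u x) \<partial>lborel)"
    by (subst nn_integral_multc) (auto simp: KA)
  finally have "(\<integral>\<^sup>+ x. ennreal_powr (hausdorff q g x) p * ennreal (u x) \<partial>lborel)
     \<le> ennreal (A powr (p - 1)) * (ennreal A * (\<integral>\<^sup>+ x. ennreal (g x powr p * u x) \<partial>lborel))"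
    by (simp add: mult_left_mono)
  also have "\<dots> = ennreal (A powr (p - 1) * A) * (\<integral>\<^sup>+ x. ennreal (g x powr p * u x) \<partial>lborel)"
    using A0 by (simp add: ennreal_mult mult.assoc)
  also have "A powr (p - 1) * A = A powr p"
    using A0 by (cases "A = 0") (auto simp: powr_diff)
  finally show ?thesis .
qed

section \<open>Lower bound for nonnegative Hausdorff operators\<close>

text \<open>A square with side \<open>2 r\<close> in each quadrant, in the logarithmic coordinates that turn
  dilations into translations.\<close>

definition log_square :: "real \<Rightarrow> (real \<times> real) set" where
  "log_square r = {x. off_axes x \<and> \<bar>ln \<bar>fst x\<bar>\<bar> \<le> r \<and> \<bar>ln \<bar>snd x\<bar>\<bar> \<le> r}"

lemma log_square_measurable [measurable]: "log_square r \<in> sets borel"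
  unfolding log_square_def by measurable

lemma scale_coord_inverse_log_square:
  assumes x: "x \<in> log_square a" and t: "t \<in> log_square b"
  shows "scale (coord_inverse t) x \<in> log_square (a + b)"
proof -
  have "\<bar>ln \<bar>y / s\<bar>\<bar> \<le> a + b" if "y \<noteq> 0" "s \<noteq> 0" "\<bar>ln \<bar>y\<bar>\<bar> \<le> a" "\<bar>ln \<bar>s\<bar>\<bar> \<le> b" for y s :: real
    using that by (simp add: ln_div abs_divide)
  then show ?thesis
    using assms by (auto simp: log_square_def scale_def coord_inverse_def off_axes_def)
qed

lemma nn_integral_reciprocal_log_interval:
  assumes "0 \<le> r"
  shows "(\<integral>\<^sup>+ s. ennreal (indicator {s. s \<noteq> 0 \<and> \<bar>ln \<bar>s\<bar>\<bar> \<le> r} s / \<bar>s\<bar>) \<partial>lborel) = ennreal (4 * r)"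
proof -
  define I where "I s = ennreal (1 / s) * indicator {exp (- r)..exp r} s" for s
  have [measurable]: "I \<in> borel_measurable borel"
    unfolding I_def by measurable
  have "(\<integral>\<^sup>+ s. I s \<partial>lborel) = ennreal (ln (exp r) - ln (exp (- r)))"
    unfolding I_def
  proof (rule nn_integral_FTC_Icc)
    fix x assume "x \<in> {exp (- r)..exp r}"
    then have "0 < x" by (auto intro: less_le_trans[OF exp_gt_zero])
    then show "DERIV ln x :> 1 / x" "0 \<le> 1 / x"
      by (auto intro!: derivative_eq_intros)
  qed (use assms in auto)
  then have I: "(\<integral>\<^sup>+ s. I s \<partial>lborel) = ennreal (2 * r)" by simp
  have pt: "ennreal (indicator {s. s \<noteq> 0 \<and> \<bar>ln \<bar>s\<bar>\<bar> \<le> r} s / \<bar>s\<bar>) = I s + I (- s)" for s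
  proof -
    have ln: "\<bar>ln y\<bar> \<le> r \<longleftrightarrow> y \<in> {exp (- r)..exp r}" if "0 < y" for y
      using that ln_ge_iff[of y "- r"] ln_le_cancel_iff[of y "exp r"] by (auto simp: abs_le_iff)
    have non: "y \<notin> {exp (- r)..exp r}" if "y \<le> 0" for y
      using that exp_gt_zero[of "- r"] by (auto simp del: exp_gt_zero)
    consider "s = 0" | "0 < s" | "s < 0" by linarith
    then show ?thesis
    proof cases
      case 1 then show ?thesis by (simp add: I_def)
    next
      case 2
      then show ?thesis using ln[of s] non[of "- s"] by (auto simp: I_def indicator_def ennreal_neg)
    next
      case 3
      then show ?thesis using ln[of "- s"] non[of s] by (auto simp: I_def indicator_def ennreal_neg)
    qed
  qed
  have "(\<integral>\<^sup>+ s. I (- s) \<partial>lborel) = (\<integral>\<^sup>+ s. I s \<partial>lborel)"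
    by (subst (2) nn_integral_real_affine[where c = "- 1" and t = 0]) auto
  then show ?thesis
    unfolding pt using assms by (simp add: nn_integral_add I flip: ennreal_plus)
qed

text \<open>In logarithmic coordinates this is the Euclidean area of four squares with side \<open>2 r\<close>.\<close>

lemma nn_integral_reciprocal_log_square:
  assumes "0 \<le> r"
  shows "(\<integral>\<^sup>+ x. ennreal (indicator (log_square r) x / \<bar>fst x * snd x\<bar>) \<partial>lborel) = ennreal (16 * r\<^sup>2)"
proof -
  define L where "L s = indicator {s. s \<noteq> 0 \<and> \<bar>ln \<bar>s\<bar>\<bar> \<le> r} s / \<bar>s\<bar>" for s :: real
  have [measurable]: "L \<in> borel_measurable borel"
    unfolding L_def by measurable
  have L: "(\<integral>\<^sup>+ s. ennreal (L s) \<partial>lborel) = ennreal (4 * r)"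
    unfolding L_def by (rule nn_integral_reciprocal_log_interval[OF assms])
  have "(\<integral>\<^sup>+ x. ennreal (indicator (log_square r) x / \<bar>fst x * snd x\<bar>) \<partial>lborel)
     = (\<integral>\<^sup>+ x. ennreal (L (fst x)) * ennreal (L (snd x)) \<partial>lborel)"
    by (intro nn_integral_cong) (auto simp: L_def log_square_def off_axes_def indicator_def abs_mult
       simp flip: ennreal_mult)
  also have "\<dots> = (\<integral>\<^sup>+ a. \<integral>\<^sup>+ b. ennreal (L a) * ennreal (L b) \<partial>lborel \<partial>lborel)"
    unfolding lborel_prod[symmetric] by (subst lborel.nn_integral_fst[symmetric]) auto
  also have "\<dots> = ennreal (4 * r) * ennreal (4 * r)"
    by (simp add: nn_integral_cmult nn_integral_multc L)
  also have "\<dots> = ennreal (16 * r\<^sup>2)"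
    using assms by (simp add: power2_eq_square flip: ennreal_mult)
  finally show ?thesis .
qed

text \<open>The function \<open>h x = (u x * \<bar>x\<^sub>1 x\<^sub>2\<bar>) powr (- 1/p)\<close> behaves well under all dilations: at almost
  every point, \<open>h\<close> composed with the inverse of the dilation by \<open>t\<close> is at least
  \<open>(\<bar>t\<^sub>1 t\<^sub>2\<bar> * m t) powr (1/p) * h\<close>. Since \<open>h\<close> is not in the space, it is cut off to the logarithmic square
  of size \<open>d + s\<close>. For \<open>x\<close> in the square of size \<open>d\<close> and \<open>t\<close> in the square of size \<open>s\<close> the cut-off is
  not seen, so \<open>A powr p * 16 d\<^sup>2 \<le> C powr p * 16 (d + s)\<^sup>2\<close> for the part \<open>A\<close> of the integral over the square
  of size \<open>s\<close>. Letting \<open>d\<close> tend to infinity gives the claim.\<close>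

lemma hausdorff_lower_on_log_square:
  fixes q u m :: "real \<times> real \<Rightarrow> real"
  assumes p: "1 < p" and C: "0 \<le> C" and s: "0 \<le> s"
    and [measurable]: "q \<in> borel_measurable borel" "u \<in> borel_measurable borel" "m \<in> borel_measurable borel"
    and q: "\<And>t. 0 \<le> q t" and u: "\<And>x. 0 < u x"
    and m: "\<And>t. off_axes t \<Longrightarrow> 0 < m t"
    and um: "\<And>t. off_axes t \<Longrightarrow> AE y in lborel. m t * u y \<le> u (scale t y)"
    and bound: "\<And>g. g \<in> borel_measurable borel \<Longrightarrow> (\<And>x. 0 \<le> g x) \<Longrightarrow>
        (\<integral>\<^sup>+ x. ennreal (g x powr p * u x) \<partial>lborel) < \<infinity> \<Longrightarrow>
        (\<integral>\<^sup>+ x. ennreal_powr (hausdorff q g x) p * ennreal (u x) \<partial>lborel)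
          \<le> ennreal (C powr p) * (\<integral>\<^sup>+ x. ennreal (g x powr p * u x) \<partial>lborel)"
  shows "(\<integral>\<^sup>+ t. ennreal (q t * (\<bar>fst t * snd t\<bar> * m t) powr (1 / p)) * indicator (log_square s) t \<partial>lborel)
    \<le> ennreal C"
proof -
  define J where "J t = \<bar>fst t * snd t\<bar> * m t" for t
  define K where "K t = q t * J t powr (1 / p)" for t
  define h where "h x = (u x * \<bar>fst x * snd x\<bar>) powr (- 1 / p)" for x
  have [measurable]: "J \<in> borel_measurable borel" "K \<in> borel_measurable borel" "h \<in> borel_measurable borel"
    unfolding J_def K_def h_def by measurable
  have h0: "0 \<le> h x" for x by (simp add: h_def)
  have hp: "h x powr p * u x = 1 / \<bar>fst x * snd x\<bar>" if "off_axes x" for x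
    using that p u[of x] by (simp add: h_def powr_powr powr_minus_divide powr_divide off_axes_def)
  define A where "A = (\<integral>\<^sup>+ t. ennreal (K t) * indicator (log_square s) t \<partial>lborel)"
  have AE: "AE x in lborel. AE t in lborel. off_axes t \<and> m t * u (scale (coord_inverse t) x) \<le> u x"
  proof (rule AE_swap_off_axes)
    fix t :: "real \<times> real" assume "off_axes t"
    then show "AE x in lborel. m t * u (scale (coord_inverse t) x) \<le> u x"
      using AE_scale[OF um, of t "coord_inverse t"]
      by (simp add: off_axes_coord_inverse scale_coord_inverse)
  qed measurable
  have main: "ennreal_powr A p * ennreal (16 * d\<^sup>2) \<le> ennreal (C powr p * (16 * (d + s)\<^sup>2))" if d: "0 < d" for d
  proof -
    define g where "g x = indicator (log_square (d + s)) x * h x" for x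
    have [measurable]: "g \<in> borel_measurable borel"
      unfolding g_def by measurable
    have g0: "0 \<le> g x" for x by (simp add: g_def h0)
    have "(\<integral>\<^sup>+ x. ennreal (g x powr p * u x) \<partial>lborel)
        = (\<integral>\<^sup>+ x. ennreal (indicator (log_square (d + s)) x / \<bar>fst x * snd x\<bar>) \<partial>lborel)"
      using p by (intro nn_integral_cong) (auto simp: g_def indicator_def hp log_square_def)
    also have "\<dots> = ennreal (16 * (d + s)\<^sup>2)"
      using d s by (intro nn_integral_reciprocal_log_square) simp
    finally have g_norm: "(\<integral>\<^sup>+ x. ennreal (g x powr p * u x) \<partial>lborel) = ennreal (16 * (d + s)\<^sup>2)" .
    have low: "AE x in lborel. ennreal_powr A p * ennreal (indicator (log_square d) x / \<bar>fst x * snd x\<bar>)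
        \<le> ennreal_powr (hausdorff q g x) p * ennreal (u x)"
      using AE
    proof eventually_elim
      case (elim x)
      show ?case
      proof (cases "x \<in> log_square d")
        case x: True
        have "ennreal (h x) * A = (\<integral>\<^sup>+ t. ennreal (h x) * (ennreal (K t) * indicator (log_square s) t) \<partial>lborel)"
          unfolding A_def by (rule nn_integral_cmult[symmetric]) measurable
        also have "\<dots> \<le> hausdorff q g x"
          unfolding hausdorff_def
        proof (rule nn_integral_mono_AE)
          show "AE t in lborel. ennreal (h x) * (ennreal (K t) * indicator (log_square s) t)
              \<le> ennreal (q t * g (scale (coord_inverse t) x))"
            using elim
          proof eventually_elim
            case (elim t)
            show ?case
            proof (cases "t \<in> log_square s")
              case t: True
              let ?y = "scale (coord_inverse t) x"
              have ot: "off_axes t" and ox: "off_axes x"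
                using t x by (auto simp: log_square_def)
              have y: "?y \<in> log_square (d + s)"
                using x t by (rule scale_coord_inverse_log_square)
              have "u ?y * \<bar>fst ?y * snd ?y\<bar> = m t * u ?y * \<bar>fst x * snd x\<bar> / J t"
                using m[OF ot] ot by (simp add: J_def scale_def coord_inverse_def off_axes_def abs_mult)
              also have "\<dots> \<le> u x * \<bar>fst x * snd x\<bar> / J t"
                using elim ot m[OF ot] by (intro divide_right_mono mult_right_mono) (auto simp: J_def)
              finally have "(u x * \<bar>fst x * snd x\<bar> / J t) powr (- 1 / p) \<le> h ?y"
                unfolding h_def using p u[of ?y] y
                by (intro powr_mono2') (auto simp: log_square_def off_axes_def)
              moreover have "(u x * \<bar>fst x * snd x\<bar> / J t) powr (- 1 / p) = h x * J t powr (1 / p)"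
                using u[of x] m[OF ot]
                by (simp add: h_def powr_divide powr_minus_divide J_def)
              ultimately have "q t * (h x * J t powr (1 / p)) \<le> q t * h ?y"
                by (intro mult_left_mono q) simp
              then have "h x * K t \<le> q t * g ?y"
                using y by (simp add: K_def g_def mult.left_commute)
              then show ?thesis
                using t h0 q by (simp add: K_def flip: ennreal_mult) (simp add: ennreal_leI)
            qed simp
          qed
        qed
        finally have "ennreal_powr (ennreal (h x) * A) p \<le> ennreal_powr (hausdorff q g x) p"
          using p by (intro ennreal_powr_mono) auto
        then have "ennreal_powr (ennreal (h x) * A) p * ennreal (u x)
            \<le> ennreal_powr (hausdorff q g x) p * ennreal (u x)"
          by (rule mult_right_mono) simp
        moreover have "ennreal_powr (ennreal (h x) * A) p * ennreal (u x)
            = ennreal_powr A p * ennreal (h x powr p * u x)"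
          using p h0 u[of x]
          by (simp add: ennreal_powr_mult ennreal_powr_ennreal ennreal_mult less_imp_le mult.left_commute mult.commute)
        ultimately show ?thesis
          using x by (simp add: hp log_square_def)
      qed simp
    qed
    have "ennreal_powr A p * ennreal (16 * d\<^sup>2)
       = (\<integral>\<^sup>+ x. ennreal_powr A p * ennreal (indicator (log_square d) x / \<bar>fst x * snd x\<bar>) \<partial>lborel)"
      using d by (subst nn_integral_cmult) (auto simp: nn_integral_reciprocal_log_square)
    also have "\<dots> \<le> (\<integral>\<^sup>+ x. ennreal_powr (hausdorff q g x) p * ennreal (u x) \<partial>lborel)"
      using low by (rule nn_integral_mono_AE)
    also have "\<dots> \<le> ennreal (C powr p) * (\<integral>\<^sup>+ x. ennreal (g x powr p * u x) \<partial>lborel)"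
      by (rule bound) (auto simp: g0 g_norm)
    also have "\<dots> = ennreal (C powr p * (16 * (d + s)\<^sup>2))"
      using C by (simp add: g_norm ennreal_mult)
    finally show ?thesis .
  qed
  have "A < \<infinity>"
  proof (rule ccontr)
    assume "\<not> A < \<infinity>"
    then have "A = \<infinity>" by (cases A) auto
    then show False
      using main[of 1] by (simp add: ennreal_powr_def ennreal_top_mult top_unique)
  qed
  then obtain a where a: "A = ennreal a" "0 \<le> a"
    by (cases A) auto
  have "a powr p * d\<^sup>2 \<le> C powr p * (d + s)\<^sup>2" if "0 < d" for d
    using main[OF that] a
    by (simp add: ennreal_powr_ennreal ennreal_le_iff flip: ennreal_mult)
  then have "a powr p \<le> C powr p * (1 + s / d)\<^sup>2" if "0 < d" for d
    using that[THEN \<open>\<And>d. 0 < d \<Longrightarrow> a powr p * d\<^sup>2 \<le> C powr p * (d + s)\<^sup>2\<close>] that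
    by (simp add: field_simps power2_eq_square)
  then have "eventually (\<lambda>d. a powr p \<le> C powr p * (1 + s / d)\<^sup>2) at_top"
    by (intro eventually_mono[OF eventually_gt_at_top[of 0]]) auto
  moreover have "((\<lambda>d. s / d) \<longlongrightarrow> 0) at_top"
    by (rule tendsto_divide_0[OF tendsto_const filterlim_at_top_imp_at_infinity[OF filterlim_ident]])
  then have "((\<lambda>d. C powr p * (1 + s / d)\<^sup>2) \<longlongrightarrow> C powr p * (1 + 0)\<^sup>2) at_top"
    by (intro tendsto_mult tendsto_power tendsto_add tendsto_const)
  ultimately have "a powr p \<le> C powr p * (1 + 0)\<^sup>2"
    by (intro tendsto_lowerbound) auto
  then have "\<not> C < a"
    using powr_less_mono2[of p C a] C p by auto
  then have "a \<le> C" by simp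
  then show ?thesis
    using a by (simp add: A_def K_def J_def ennreal_leI)
qed

lemma hausdorff_lower:
  fixes q u m :: "real \<times> real \<Rightarrow> real"
  assumes p: "1 < p" and C: "0 \<le> C"
    and [measurable]: "q \<in> borel_measurable borel" "u \<in> borel_measurable borel" "m \<in> borel_measurable borel"
    and q: "\<And>t. 0 \<le> q t" and u: "\<And>x. 0 < u x"
    and m: "\<And>t. off_axes t \<Longrightarrow> 0 < m t"
    and um: "\<And>t. off_axes t \<Longrightarrow> AE y in lborel. m t * u y \<le> u (scale t y)"
    and bound: "\<And>g. g \<in> borel_measurable borel \<Longrightarrow> (\<And>x. 0 \<le> g x) \<Longrightarrow>
        (\<integral>\<^sup>+ x. ennreal (g x powr p * u x) \<partial>lborel) < \<infinity> \<Longrightarrow>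
        (\<integral>\<^sup>+ x. ennreal_powr (hausdorff q g x) p * ennreal (u x) \<partial>lborel)
          \<le> ennreal (C powr p) * (\<integral>\<^sup>+ x. ennreal (g x powr p * u x) \<partial>lborel)"
  shows "(\<integral>\<^sup>+ t. ennreal (q t * (\<bar>fst t * snd t\<bar> * m t) powr (1 / p)) \<partial>lborel) \<le> ennreal C"
proof -
  let ?K = "\<lambda>t. ennreal (q t * (\<bar>fst t * snd t\<bar> * m t) powr (1 / p))"
  have "(\<integral>\<^sup>+ t. ?K t \<partial>lborel) \<le> (\<integral>\<^sup>+ t. (SUP n. ?K t * indicator (log_square (real n)) t) \<partial>lborel)"
  proof (rule nn_integral_mono_AE)
    show "AE t in lborel. ?K t \<le> (SUP n. ?K t * indicator (log_square (real n)) t)"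
      using AE_off_axes
    proof eventually_elim
      case (elim t)
      obtain n where "max (\<bar>ln \<bar>fst t\<bar>\<bar>) (\<bar>ln \<bar>snd t\<bar>\<bar>) \<le> real n"
        using real_arch_simple by blast
      with elim have "t \<in> log_square (real n)"
        by (simp add: log_square_def)
      then show ?case
        by (intro SUP_upper2[of n]) auto
    qed
  qed
  also have "\<dots> = (SUP n. \<integral>\<^sup>+ t. ?K t * indicator (log_square (real n)) t \<partial>lborel)"
    by (rule nn_integral_monotone_convergence_SUP)
      (auto simp: incseq_def le_fun_def log_square_def indicator_def)
  also have "\<dots> \<le> ennreal C"
    by (intro SUP_least hausdorff_lower_on_log_square[OF p C]) (auto intro: q u m um bound)
  finally show ?thesis .
qed

section \<open>The Dunkl-Hausdorff operator\<close>

definition dunkl_kernel :: "real \<Rightarrow> (real \<times> real \<Rightarrow> real) \<Rightarrow> real \<times> real \<Rightarrow> real" where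
  "dunkl_kernel \<alpha> \<phi> t = \<bar>\<phi> t\<bar> / \<bar>fst t * snd t\<bar> powr (2 * \<alpha> + 2)"

lemma dunkl_kernel_nonneg: "0 \<le> dunkl_kernel \<alpha> \<phi> t"
  by (simp add: dunkl_kernel_def)

lemma dunkl_kernel_measurable [measurable]:
  assumes [measurable]: "\<phi> \<in> borel_measurable borel"
  shows "dunkl_kernel \<alpha> \<phi> \<in> borel_measurable borel"
  unfolding dunkl_kernel_def by measurable

lemma dunkl_kernel_weighted:
  assumes "off_axes t" "0 \<le> y"
  shows "dunkl_kernel \<alpha> \<phi> t * (\<bar>fst t * snd t\<bar> * y) powr (1 / p)
    = \<bar>\<phi> t\<bar> / \<bar>fst t * snd t\<bar> powr (2 * \<alpha> + 2 - 1 / p) * y powr (1 / p)"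
  using assms by (simp add: dunkl_kernel_def powr_mult powr_diff off_axes_def)

text \<open>Changing \<open>\<phi>\<close> and \<open>f\<close> on null sets changes neither the convergence nor the value of the
  defining integral at almost every point; this reduces everything to Borel functions, to which
  Fubini's theorem applies.\<close>

lemma dunkl_hausdorff_representation:
  assumes \<phi>: "AE t in lborel. \<phi> t = \<psi> t" and f: "AE x in lborel. f x = g x"
    and [measurable]: "\<psi> \<in> borel_measurable borel" "g \<in> borel_measurable borel"
  shows "AE x in lborel.
      (integrable lebesgue (dunkl_hausdorff_integrand \<alpha> \<phi> f x)
        \<longleftrightarrow> integrable lborel (\<lambda>t. dunkl_kernel \<alpha> \<psi> t * g (scale (coord_inverse t) x))) \<and>
      dunkl_hausdorff \<alpha> \<phi> f x = (\<integral>t. dunkl_kernel \<alpha> \<psi> t * g (scale (coord_inverse t) x) \<partial>lborel)"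
  using AE_dilated_argument[OF f]
proof eventually_elim
  case (elim x)
  let ?F = "dunkl_hausdorff_integrand \<alpha> \<phi> f x"
  let ?G = "\<lambda>t. dunkl_kernel \<alpha> \<psi> t * g (scale (coord_inverse t) x)"
  have G [measurable]: "?G \<in> borel_measurable borel"
    by measurable
  then have G_leb: "?G \<in> borel_measurable lebesgue"
    by (simp add: measurable_completion)
  have "AE t in lborel. ?G t = ?F t"
    using elim \<phi> by eventually_elim
      (simp add: dunkl_hausdorff_integrand_def dunkl_kernel_def scale_def coord_inverse_def)
  then have eq: "AE t in lebesgue. ?G t = ?F t"
    by (rule AE_completion)
  have F_leb: "?F \<in> borel_measurable lebesgue"
    using G_leb eq by (rule borel_measurable_AE)
  have "integrable lebesgue ?F \<longleftrightarrow> integrable lebesgue ?G"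
    using eq by (intro integrable_cong_AE[OF F_leb G_leb]) (auto elim: eventually_mono)
  also have "\<dots> \<longleftrightarrow> integrable lborel ?G"
    using G by (intro integrable_completion) simp
  finally have 1: "integrable lebesgue ?F \<longleftrightarrow> integrable lborel ?G" .
  have "dunkl_hausdorff \<alpha> \<phi> f x = integral\<^sup>L lebesgue ?G"
    unfolding dunkl_hausdorff_def
    using eq by (intro integral_cong_AE[OF F_leb G_leb]) (auto elim: eventually_mono)
  also have "\<dots> = integral\<^sup>L lborel ?G"
    using G by (intro integral_completion) simp
  finally show ?case using 1 by simp
qed

lemma integrable_iff_hausdorff_finite:
  assumes [measurable]: "q \<in> borel_measurable borel" "g \<in> borel_measurable borel" and q: "\<And>t. 0 \<le> q t"
  shows "integrable lborel (\<lambda>t. q t * g (scale (coord_inverse t) x)) \<longleftrightarrow> hausdorff q (\<lambda>y. \<bar>g y\<bar>) x < \<infinity>"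
proof -
  have "(\<lambda>t. q t * g (scale (coord_inverse t) x)) \<in> borel_measurable lborel"
    by measurable
  then show ?thesis
    using q by (simp add: integrable_iff_bounded hausdorff_def abs_mult)
qed

lemma Lp_norm_representative:
  assumes "AE x in lborel. v x = ennreal (u x)" "AE x in lborel. f x = g x"
  shows "Lp_norm p v f = ennreal_powr (\<integral>\<^sup>+ x. ennreal (\<bar>g x\<bar> powr p * u x) \<partial>lborel) (1 / p)"
proof -
  have "(\<integral>\<^sup>+ x. ennreal (\<bar>f x\<bar> powr p) * v x \<partial>lborel) = (\<integral>\<^sup>+ x. ennreal (\<bar>g x\<bar> powr p * u x) \<partial>lborel)"
    by (rule nn_integral_cong_AE, use assms in eventually_elim) (simp add: ennreal_mult')
  then show ?thesis
    by (simp add: Lp_norm_def nn_integral_completion)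
qed

text \<open>The bound for the nonnegative operator applied to \<open>\<bar>g\<bar>\<close> has two uses: its finiteness gives
  absolute convergence almost everywhere, that is, the function is in the domain, and it
  dominates the norm of the image.\<close>

lemma dunkl_hausdorff_upper:
  fixes u M \<psi> :: "real \<times> real \<Rightarrow> real"
  assumes p: "1 < p"
    and [measurable]: "\<psi> \<in> borel_measurable borel" "u \<in> borel_measurable borel" "M \<in> borel_measurable borel"
    and \<phi>: "AE t in lborel. \<phi> t = \<psi> t"
    and v: "AE x in lborel. v x = ennreal (u x)" and u: "\<And>x. 0 < u x"
    and M: "\<And>t. off_axes t \<Longrightarrow> 0 < M t"
    and uM: "\<And>t. off_axes t \<Longrightarrow> AE y in lborel. u (scale t y) \<le> M t * u y"
    and A: "(\<integral>\<^sup>+ t. ennreal (dunkl_kernel \<alpha> \<psi> t * (\<bar>fst t * snd t\<bar> * M t) powr (1 / p)) \<partial>lborel) = ennreal A"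
    and A0: "0 \<le> A"
  shows "operator_bound (dunkl_hausdorff_dom \<alpha> \<phi>) (dunkl_hausdorff \<alpha> \<phi>) p v A"
proof -
  have main: "f \<in> dunkl_hausdorff_dom \<alpha> \<phi> \<and> dunkl_hausdorff \<alpha> \<phi> f \<in> Lp_space p v
      \<and> Lp_norm p v (dunkl_hausdorff \<alpha> \<phi> f) \<le> ennreal A * Lp_norm p v f" if f: "f \<in> Lp_space p v" for f
  proof -
    let ?q = "dunkl_kernel \<alpha> \<psi>" and ?T = "dunkl_hausdorff \<alpha> \<phi> f"
    obtain g where g [measurable]: "g \<in> borel_measurable borel" and fg: "AE x in lborel. f x = g x"
      using f completion_ex_borel_measurable_real[of f lborel] by (auto simp: Lp_space_def)
    let ?I = "\<integral>\<^sup>+ x. ennreal (\<bar>g x\<bar> powr p * u x) \<partial>lborel"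
    have norm_f: "Lp_norm p v f = ennreal_powr ?I (1 / p)"
      by (rule Lp_norm_representative[OF v fg])
    then have I: "?I < \<infinity>"
      using f by (simp add: Lp_space_def ennreal_powr_less_top_iff)
    define H where "H = hausdorff ?q (\<lambda>y. \<bar>g y\<bar>)"
    have [measurable]: "H \<in> borel_measurable borel"
      unfolding H_def hausdorff_def by measurable
    have upper: "(\<integral>\<^sup>+ x. ennreal_powr (H x) p * ennreal (u x) \<partial>lborel) \<le> ennreal (A powr p) * ?I"
      unfolding H_def
      by (rule hausdorff_upper[OF p _ _ _ _ _ _ u M uM A A0]) (auto simp: dunkl_kernel_nonneg)
    also have "\<dots> < \<infinity>"
      using I by (simp add: ennreal_mult_less_top)
    finally have "AE x in lborel. ennreal_powr (H x) p * ennreal (u x) \<noteq> \<infinity>"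
      by (intro nn_integral_PInf_AE) auto
    then have H: "AE x in lborel. H x < \<infinity>"
    proof eventually_elim
      case (elim x)
      then show ?case
        using u[of x] by (cases "H x") (auto simp: ennreal_powr_def ennreal_top_mult)
    qed
    define h where "h x = (\<integral>t. ?q t * g (scale (coord_inverse t) x) \<partial>lborel)" for x
    have [measurable]: "h \<in> borel_measurable borel"
      unfolding h_def by measurable
    note rep = dunkl_hausdorff_representation[OF \<phi> fg assms(2) g, of \<alpha>]
    have "AE x in lborel. integrable lebesgue (dunkl_hausdorff_integrand \<alpha> \<phi> f x)"
      using rep H by eventually_elim
        (simp add: integrable_iff_hausdorff_finite dunkl_kernel_nonneg H_def)
    then have dom: "f \<in> dunkl_hausdorff_dom \<alpha> \<phi>"
      by (simp add: dunkl_hausdorff_dom_def AE_completion)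
    have Th: "AE x in lborel. ?T x = h x"
      using rep by eventually_elim (simp add: h_def)
    have "h \<in> borel_measurable lebesgue"
      by (simp add: measurable_completion)
    then have T_meas: "?T \<in> borel_measurable lebesgue"
      by (rule borel_measurable_AE) (rule AE_completion, use Th in eventually_elim, simp)
    have hH: "ennreal \<bar>h x\<bar> \<le> H x" for x
    proof (cases "integrable lborel (\<lambda>t. ?q t * g (scale (coord_inverse t) x))")
      case True
      from integral_norm_bound_ennreal[OF this] show ?thesis
        by (simp add: h_def H_def hausdorff_def abs_mult dunkl_kernel_nonneg)
    qed (simp add: h_def not_integrable_integral_eq)
    have "(\<integral>\<^sup>+ x. ennreal (\<bar>h x\<bar> powr p * u x) \<partial>lborel)
        \<le> (\<integral>\<^sup>+ x. ennreal_powr (H x) p * ennreal (u x) \<partial>lborel)"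
    proof (rule nn_integral_mono)
      fix x
      have "ennreal (\<bar>h x\<bar> powr p) \<le> ennreal_powr (H x) p"
        using ennreal_powr_mono[OF _ hH[of x], of p] p by (simp add: ennreal_powr_ennreal)
      then show "ennreal (\<bar>h x\<bar> powr p * u x) \<le> ennreal_powr (H x) p * ennreal (u x)"
        by (simp add: ennreal_mult' mult_right_mono)
    qed
    then have "Lp_norm p v ?T \<le> ennreal_powr (ennreal (A powr p) * ?I) (1 / p)"
      unfolding Lp_norm_representative[OF v Th]
      using upper p by (intro ennreal_powr_mono) auto
    also have "\<dots> = ennreal A * Lp_norm p v f"
      using p A0 by (simp add: ennreal_powr_mult norm_f ennreal_powr_ennreal powr_powr)
    finally have le: "Lp_norm p v ?T \<le> ennreal A * Lp_norm p v f" .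
    also have "\<dots> < \<infinity>"
      using f by (simp add: Lp_space_def ennreal_mult_less_top)
    finally show ?thesis
      using le dom T_meas by (simp add: Lp_space_def)
  qed
  then show ?thesis
    using A0 by (auto simp: operator_bound_def)
qed

text \<open>On nonnegative functions in the space, the domain condition inside \<open>operator_bound\<close>
  makes the Bochner integral agree with the \<open>[0, \<infinity>]\<close>-valued one, so the bound
  transfers to the nonnegative operator and its lower estimate applies.\<close>

lemma dunkl_hausdorff_lower:
  fixes u m \<psi> :: "real \<times> real \<Rightarrow> real"
  assumes p: "1 < p"
    and [measurable]: "\<psi> \<in> borel_measurable borel" "u \<in> borel_measurable borel" "m \<in> borel_measurable borel"
    and \<phi>: "AE t in lborel. \<phi> t = \<psi> t"
    and v: "AE x in lborel. v x = ennreal (u x)" and u: "\<And>x. 0 < u x"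
    and m: "\<And>t. off_axes t \<Longrightarrow> 0 < m t"
    and um: "\<And>t. off_axes t \<Longrightarrow> AE y in lborel. m t * u y \<le> u (scale t y)"
    and C: "operator_bound (dunkl_hausdorff_dom \<alpha> \<phi>) (dunkl_hausdorff \<alpha> \<phi>) p v C"
  shows "(\<integral>\<^sup>+ t. ennreal (dunkl_kernel \<alpha> \<psi> t * (\<bar>fst t * snd t\<bar> * m t) powr (1 / p)) \<partial>lborel) \<le> ennreal C"
proof -
  let ?q = "dunkl_kernel \<alpha> \<psi>"
  have C0: "0 \<le> C" using C by (simp add: operator_bound_def)
  show ?thesis
  proof (rule hausdorff_lower[OF p C0 _ _ _ dunkl_kernel_nonneg u m um])
    fix g :: "real \<times> real \<Rightarrow> real"
    assume g [measurable]: "g \<in> borel_measurable borel" and g0: "\<And>x. 0 \<le> g x"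
      and fin: "(\<integral>\<^sup>+ x. ennreal (g x powr p * u x) \<partial>lborel) < \<infinity>"
    let ?T = "dunkl_hausdorff \<alpha> \<phi> g"
    let ?I = "\<integral>\<^sup>+ x. ennreal (g x powr p * u x) \<partial>lborel"
    have norm_g: "Lp_norm p v g = ennreal_powr ?I (1 / p)"
      using Lp_norm_representative[OF v, of g g] g0 by simp
    then have "g \<in> Lp_space p v"
      using fin g by (simp add: Lp_space_def ennreal_powr_less_top_iff measurable_completion)
    then have dom: "AE x in lborel. integrable lebesgue (dunkl_hausdorff_integrand \<alpha> \<phi> g x)"
      and le: "Lp_norm p v ?T \<le> ennreal C * Lp_norm p v g"
      using C by (auto simp: operator_bound_def dunkl_hausdorff_dom_def AE_completion_iff)
    have "AE x in lborel. ennreal_powr (hausdorff ?q g x) p = ennreal (\<bar>?T x\<bar> powr p)"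
      using dom dunkl_hausdorff_representation[OF \<phi> AE_I2[OF refl] assms(2) g, of \<alpha>]
    proof eventually_elim
      case (elim x)
      have "0 \<le> ?q t * g (scale (coord_inverse t) x)" for t
        using g0 dunkl_kernel_nonneg by (rule mult_nonneg_nonneg[rotated])
      then have "hausdorff ?q g x = ennreal (?T x)" "0 \<le> ?T x"
        using elim by (auto simp: hausdorff_def intro!: nn_integral_eq_integral)
      then show ?case
        by (simp add: ennreal_powr_ennreal)
    qed
    then have "(\<integral>\<^sup>+ x. ennreal_powr (hausdorff ?q g x) p * ennreal (u x) \<partial>lborel)
        = (\<integral>\<^sup>+ x. ennreal (\<bar>?T x\<bar> powr p * u x) \<partial>lborel)"
      by (intro nn_integral_cong_AE, eventually_elim) (simp add: ennreal_mult')
    also have "\<dots> = ennreal_powr (Lp_norm p v ?T) p"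
      using p by (simp add: Lp_norm_representative[OF v, of ?T ?T] ennreal_powr_cancel)
    also have "\<dots> \<le> ennreal_powr (ennreal C * Lp_norm p v g) p"
      using le p by (intro ennreal_powr_mono) auto
    also have "\<dots> = ennreal (C powr p) * ?I"
      using p C0 by (simp add: ennreal_powr_mult norm_g ennreal_powr_ennreal ennreal_powr_cancel)
    finally show "(\<integral>\<^sup>+ x. ennreal_powr (hausdorff ?q g x) p * ennreal (u x) \<partial>lborel)
        \<le> ennreal (C powr p) * ?I" .
  qed auto
qed

theorem theorem3p4:
  fixes p \<alpha> c :: real
    and v :: "real \<times> real \<Rightarrow> ennreal"
    and \<phi> :: "real \<times> real \<Rightarrow> real"
  assumes "1 < p"
    and "weight v"
    and "integrable lebesgue \<phi>"
    and "0 < c"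
    and "\<forall>t1 t2. t1 \<noteq> 0 \<and> t2 \<noteq> 0 \<longrightarrow>
           ratio_sup v (t1, t2) \<le> ennreal c * ratio_inf v (t1, t2)"
  shows "(operator_bounded (dunkl_hausdorff_dom \<alpha> \<phi>) (dunkl_hausdorff \<alpha> \<phi>) p v
            \<longleftrightarrow> A_sup \<alpha> \<phi> p v < \<infinity>) \<and>
         ennreal (1 / c) * A_sup \<alpha> \<phi> p v
            \<le> operator_norm (dunkl_hausdorff_dom \<alpha> \<phi>) (dunkl_hausdorff \<alpha> \<phi>) p v \<and>
         operator_norm (dunkl_hausdorff_dom \<alpha> \<phi>) (dunkl_hausdorff \<alpha> \<phi>) p v
            \<le> A_sup \<alpha> \<phi> p v"
proof -
  note p = \<open>1 < p\<close>
  have ratio: "ratio_sup v t \<le> ennreal c * ratio_inf v t" if "off_axes t" for t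
    using assms(5) that by (cases t) (auto simp: off_axes_def)
  have c: "1 \<le> c"
    using comparison_constant_ge_1[OF assms(2)] ratio[of "(1, 1)"] by (simp add: off_axes_def)
  obtain \<psi> where \<psi> [measurable]: "\<psi> \<in> borel_measurable borel" and \<phi>\<psi>: "AE t in lborel. \<phi> t = \<psi> t"
    using completion_ex_borel_measurable_real[of \<phi> lborel] assms(3) by auto
  obtain u m M :: "real \<times> real \<Rightarrow> real"
    where meas [measurable]: "u \<in> borel_measurable borel" "m \<in> borel_measurable borel" "M \<in> borel_measurable borel"
      and u: "\<And>x. 0 < u x" and v: "AE x in lborel. v x = ennreal (u x)"
      and m: "\<And>t. off_axes t \<Longrightarrow> 0 < m t" and M: "\<And>t. off_axes t \<Longrightarrow> 0 < M t"
      and um: "\<And>t. off_axes t \<Longrightarrow> AE y in lborel. m t * u y \<le> u (scale t y)"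
      and uM: "\<And>t. off_axes t \<Longrightarrow> AE y in lborel. u (scale t y) \<le> M t * u y"
      and inf_m: "\<And>t. off_axes t \<Longrightarrow> ratio_inf v t \<le> ennreal (m t)"
      and M_sup: "\<And>t. off_axes t \<Longrightarrow> ennreal (M t) \<le> ratio_sup v t"
    by (rule dilation_multipliers[OF assms(2) ratio]) auto
  let ?D = "dunkl_hausdorff_dom \<alpha> \<phi>" and ?T = "dunkl_hausdorff \<alpha> \<phi>" and ?A = "A_sup \<alpha> \<phi> p v"
  define A where "A y = (\<integral>\<^sup>+ t. ennreal (dunkl_kernel \<alpha> \<psi> t * (\<bar>fst t * snd t\<bar> * y t) powr (1 / p)) \<partial>lborel)" for y
  define w where "w t = \<bar>\<psi> t\<bar> / \<bar>fst t * snd t\<bar> powr (2 * \<alpha> + 2 - 1 / p)" for t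
  have w0: "0 \<le> w t" for t by (simp add: w_def)
  have A_sup: "?A = (\<integral>\<^sup>+ t. ennreal (w t) * ennreal_powr (ratio_sup v t) (1 / p) \<partial>lborel)"
    unfolding A_sup_def nn_integral_completion w_def
    by (rule nn_integral_cong_AE, use \<phi>\<psi> in eventually_elim) simp
  have A_M: "A M \<le> ?A"
    unfolding A_def A_sup
  proof (rule nn_integral_mono_AE)
    show "AE t in lborel. ennreal (dunkl_kernel \<alpha> \<psi> t * (\<bar>fst t * snd t\<bar> * M t) powr (1 / p))
        \<le> ennreal (w t) * ennreal_powr (ratio_sup v t) (1 / p)"
      using AE_off_axes
    proof eventually_elim
      case (elim t)
      have "ennreal (w t * M t powr (1 / p)) = ennreal (w t) * ennreal_powr (ennreal (M t)) (1 / p)"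
        using M[OF elim] w0 by (simp add: ennreal_mult ennreal_powr_ennreal)
      also have "\<dots> \<le> ennreal (w t) * ennreal_powr (ratio_sup v t) (1 / p)"
        using M_sup[OF elim] p by (intro mult_left_mono ennreal_powr_mono) auto
      finally show ?case
        using dunkl_kernel_weighted[OF elim, of "M t"] M[OF elim] by (simp add: w_def)
    qed
  qed
  have A_m: "?A \<le> ennreal c * A m"
  proof -
    have "?A \<le> (\<integral>\<^sup>+ t. ennreal c * ennreal (dunkl_kernel \<alpha> \<psi> t * (\<bar>fst t * snd t\<bar> * m t) powr (1 / p)) \<partial>lborel)"
      unfolding A_sup
    proof (rule nn_integral_mono_AE)
      show "AE t in lborel. ennreal (w t) * ennreal_powr (ratio_sup v t) (1 / p)
          \<le> ennreal c * ennreal (dunkl_kernel \<alpha> \<psi> t * (\<bar>fst t * snd t\<bar> * m t) powr (1 / p))"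
        using AE_off_axes
      proof eventually_elim
        case (elim t)
        have "ratio_sup v t \<le> ennreal c * ennreal (m t)"
          using ratio[OF elim] inf_m[OF elim] by (meson mult_left_mono order_trans zero_le)
        then have "ennreal (w t) * ennreal_powr (ratio_sup v t) (1 / p)
            \<le> ennreal (w t) * ennreal_powr (ennreal c * ennreal (m t)) (1 / p)"
          using p by (intro mult_left_mono ennreal_powr_mono) auto
        also have "\<dots> = ennreal (c powr (1 / p)) * ennreal (w t * m t powr (1 / p))"
          using p c m[OF elim] w0
          by (simp add: ennreal_powr_mult ennreal_powr_ennreal ennreal_mult mult.left_commute)
        also have "\<dots> \<le> ennreal c * ennreal (w t * m t powr (1 / p))"
        proof -
          \<comment> \<open>The argument gives the constant \<open>c powr (1/p)\<close>, which is at most \<open>c\<close> because \<open>c \<ge> 1\<close>.\<close>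
          have "c powr (1 / p) \<le> c powr 1"
            using p c by (intro powr_mono) auto
          then show ?thesis
            using c by (intro mult_right_mono ennreal_leI) auto
        qed
        finally show ?case
          using dunkl_kernel_weighted[OF elim, of "m t"] m[OF elim] by (simp add: w_def)
      qed
    qed
    also have "\<dots> = ennreal c * A m"
      unfolding A_def by (rule nn_integral_cmult) measurable
    finally show ?thesis .
  qed
  have lower: "ennreal (1 / c) * ?A \<le> ennreal C" if "operator_bound ?D ?T p v C" for C
  proof -
    have "A m \<le> ennreal C"
      unfolding A_def using dunkl_hausdorff_lower[OF p \<psi> meas(1,2) \<phi>\<psi> v u m um that] by simp
    then have "?A \<le> ennreal c * ennreal C"
      using A_m by (meson mult_left_mono order_trans zero_le)
    then have "ennreal (1 / c) * ?A \<le> ennreal (1 / c) * (ennreal c * ennreal C)"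
      by (rule mult_left_mono) simp
    also have "\<dots> = ennreal C"
      using c by (simp add: mult.assoc[symmetric] flip: ennreal_mult)
    finally show ?thesis .
  qed
  have upper: "operator_bound ?D ?T p v (enn2real (A M))" if "?A < \<infinity>"
  proof -
    have "A M < \<infinity>" using A_M that by order
    then have "A M = ennreal (enn2real (A M))" by simp
    then show ?thesis
      unfolding A_def by (intro dunkl_hausdorff_upper[OF p \<psi> meas(1,3) \<phi>\<psi> v u M uM]) auto
  qed
  have "operator_bounded ?D ?T p v \<longleftrightarrow> ?A < \<infinity>"
  proof
    assume "operator_bounded ?D ?T p v"
    then obtain C where "operator_bound ?D ?T p v C"
      by (auto simp: operator_bounded_def)
    then have "ennreal (1 / c) * ?A < \<infinity>"
      using lower by (metis ennreal_less_top infinity_ennreal_def le_less_trans)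
    then show "?A < \<infinity>"
      using c by (auto simp: ennreal_mult_less_top)
  next
    assume "?A < \<infinity>"
    then show "operator_bounded ?D ?T p v"
      using upper by (auto simp: operator_bounded_def)
  qed
  moreover have "ennreal (1 / c) * ?A \<le> operator_norm ?D ?T p v"
    unfolding operator_norm_def by (intro INF_greatest) (auto intro: lower)
  moreover have "operator_norm ?D ?T p v \<le> ?A"
  proof (cases "?A < \<infinity>")
    case True
    then have "operator_norm ?D ?T p v \<le> ennreal (enn2real (A M))"
      unfolding operator_norm_def by (intro INF_lower) (simp add: upper)
    also have "\<dots> \<le> ?A"
      using A_M True by (simp add: le_less_trans)
    finally show ?thesis .
  next
    case False
    then have "?A = \<infinity>" by (cases ?A) auto
    then show ?thesis by simp
  qed
  ultimately show ?thesis by blast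
qed

end
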